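(* Let $X,Y\subset\mathbb{R}^N$ be compact sets, let $\mu\in\mathcal{P}(X)$, let $f,g:X\to\mathcal{P}(Y)$ be disintegration maps, and let $\gamma=f(x)\otimes\mu$ and $\eta=g(x)\otimes\mu$. Then $$f_\#\mu=g_\#\mu\ \Longrightarrow\ \pi^2_\#\gamma=\pi^2_\#\eta .$$
   Context: $\mathcal{P}(Z)$ denotes the set of Borel probability measures on $Z$. The set $\mathcal{P}(Y)$ is endowed with the $1$-Wasserstein distance $W(\nu_1,\nu_2)=\sup\{\int_Y\varphi\,d(\nu_1-\nu_2): \varphi:Y\to\mathbb{R}\ \text{1-Lipschitz}\}$, which metrizes the weak* topology, and with the corresponding Borel $\sigma$-algebra. A disintegration map is a map $f:X\to\mathcal{P}(Y)$ which is Borel in the sense that for every open $B\subset Y$ the function $x\mapsto f(x)(B)$ is Borel on $X$ (equivalently, $f$ is Borel measurable into $(\mathcal{P}(Y),W)$). For a disintegration map $f$, the measure $f(x)\otimes\mu\in\mathcal{P}(X\times Y)$ is defined by $\int_{X\times Y}\varphi\,d(f(x)\otimes\mu)=\int_X\left(\int_Y\varphi(x,y)\,df(x)(y)\right)d\mu(x)$ for all bounded continuous $\varphi$ on $X\times Y$. The symbol $\#$ denotes push-forward and $\pi^2:X\times Y\to Y$ is the projection on the second factor. *)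

theory Defs
  imports "HOL-Probability.Probability"
begin

definition borel_probs :: "'a::topological_space set \<Rightarrow> 'a measure set" where
  "borel_probs Z = {\<nu>. prob_space \<nu> \<and> sets \<nu> = sets (restrict_space borel Z)}"

text \<open>The value outside \<open>borel_probs Y\<close> is irrelevant; \<open>0\<close> is chosen because the locale
  \<^locale>\<open>Metric_space\<close> requires distances to be nonnegative and symmetric on the whole type.\<close>

definition wasserstein :: "'a::metric_space set \<Rightarrow> 'a measure \<Rightarrow> 'a measure \<Rightarrow> real" where
  "wasserstein Y \<nu>1 \<nu>2 =
     (if \<nu>1 \<in> borel_probs Y \<and> \<nu>2 \<in> borel_probs Y
      then SUP \<phi>\<in>{\<phi> :: 'a \<Rightarrow> real. 1-lipschitz_on Y \<phi>}. (\<integral>y. \<phi> y \<partial>\<nu>1) - (\<integral>y. \<phi> y \<partial>\<nu>2)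
      else 0)"

definition wasserstein_borel :: "'a::metric_space set \<Rightarrow> 'a measure measure" where
  "wasserstein_borel Y = sigma (borel_probs Y)
     {U. openin (Metric_space.mtopology (borel_probs Y) (wasserstein Y)) U}"

definition disintegration_map ::
    "'a::topological_space set \<Rightarrow> 'b::topological_space set \<Rightarrow> ('a \<Rightarrow> 'b measure) \<Rightarrow> bool" where
  "disintegration_map X Y f \<longleftrightarrow>
     f \<in> X \<rightarrow> borel_probs Y \<and>
     (\<forall>B. openin (top_of_set Y) B \<longrightarrow>
        (\<lambda>x. measure (f x) B) \<in> borel_measurable (restrict_space borel X))"

definition disint_prod ::
    "'a::topological_space set \<Rightarrow> 'b::topological_space set \<Rightarrow> ('a \<Rightarrow> 'b measure) \<Rightarrow> 'a measure
      \<Rightarrow> ('a \<times> 'b) measure" where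
  "disint_prod X Y f \<mu> = (THE \<gamma>. \<gamma> \<in> borel_probs (X \<times> Y) \<and>
     (\<forall>\<phi> :: 'a \<times> 'b \<Rightarrow> real. continuous_on (X \<times> Y) \<phi> \<and> bounded (\<phi> ` (X \<times> Y)) \<longrightarrow>
        (\<integral>z. \<phi> z \<partial>\<gamma>) = (\<integral>x. (\<integral>y. \<phi> (x, y) \<partial>f x) \<partial>\<mu>)))"

lemma borel_probsD:
  assumes "\<nu> \<in> borel_probs Z"
  shows "prob_space \<nu>" "sets \<nu> = sets (restrict_space borel Z)" "space \<nu> = Z"
proof -
  show "prob_space \<nu>" and s: "sets \<nu> = sets (restrict_space borel Z)"
    using assms by (auto simp: borel_probs_def)
  show "space \<nu> = Z" using sets_eq_imp_space_eq[OF s] by (simp add: space_restrict_space)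
qed

lemma borel_probs_measurable:
  fixes \<phi> :: "'a::topological_space \<Rightarrow> real"
  assumes "\<nu> \<in> borel_probs Z" "continuous_on Z \<phi>"
  shows "\<phi> \<in> borel_measurable \<nu>"
  using borel_measurable_continuous_on_restrict[OF assms(2)]
    measurable_cong_sets[OF borel_probsD(2)[OF assms(1)] refl] by blast

lemma borel_probs_integrable:
  fixes \<phi> :: "'a::topological_space \<Rightarrow> real"
  assumes \<nu>: "\<nu> \<in> borel_probs Z" and c: "continuous_on Z \<phi>" and b: "bounded (\<phi> ` Z)"
  shows "integrable \<nu> \<phi>"
proof -
  interpret prob_space \<nu> by (rule borel_probsD(1)[OF \<nu>])
  obtain K where K: "\<And>z. z \<in> Z \<Longrightarrow> norm (\<phi> z) \<le> K" using b by (auto simp: bounded_iff)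
  show ?thesis
    by (rule integrable_const_bound[of \<phi> K])
       (use K in \<open>auto intro!: AE_I2 simp: borel_probsD(3)[OF \<nu>] borel_probs_measurable[OF \<nu> c]\<close>)
qed

lemma lipschitz_on_bounded_image:
  fixes \<phi> :: "'a::metric_space \<Rightarrow> real"
  assumes "compact Z" "L-lipschitz_on Z \<phi>"
  shows "bounded (\<phi> ` Z)"
  by (meson assms compact_continuous_image compact_imp_bounded lipschitz_on_continuous_on)

lemma borel_probs_eqI:
  fixes \<nu>1 \<nu>2 :: "'a::metric_space measure"
  assumes Z: "compact Z" and p1: "\<nu>1 \<in> borel_probs Z" and p2: "\<nu>2 \<in> borel_probs Z"
    and eq: "\<And>\<phi> :: 'a \<Rightarrow> real. 1-lipschitz_on Z \<phi> \<Longrightarrow> (\<integral>z. \<phi> z \<partial>\<nu>1) = (\<integral>z. \<phi> z \<partial>\<nu>2)"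
  shows "\<nu>1 = \<nu>2"
proof -
  have eqL: "(\<integral>z. \<phi> z \<partial>\<nu>1) = (\<integral>z. \<phi> z \<partial>\<nu>2)" if l: "L-lipschitz_on Z \<phi>" for L and \<phi> :: "'a \<Rightarrow> real"
  proof -
    define M where "M = max L 1"
    have M: "M > 0" "L \<le> M" by (auto simp: M_def)
    have "M-lipschitz_on Z \<phi>" using l M(2) by (rule lipschitz_on_mono[OF _ subset_refl])
    then have "1-lipschitz_on Z (\<lambda>z. \<phi> z / M)"
      using M by (auto simp: lipschitz_on_def dist_real_def diff_divide_distrib[symmetric] field_simps)
    from eq[OF this] M show ?thesis by simp
  qed
  have lim: "(\<lambda>n. \<integral>z. max 0 (1 - real n * infdist z C) \<partial>\<nu>) \<longlonglongrightarrow> measure \<nu> (C \<inter> Z)"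
    if C: "closed C" "C \<noteq> {}" and \<nu>: "\<nu> \<in> borel_probs Z" for C \<nu>
  proof -
    interpret prob_space \<nu> by (rule borel_probsD(1)[OF \<nu>])
    have CZ: "C \<inter> Z \<in> sets \<nu>"
      using C by (auto simp: borel_probsD(2)[OF \<nu>] sets_restrict_space)
    have "(\<lambda>n. \<integral>z. max 0 (1 - real n * infdist z C) \<partial>\<nu>) \<longlonglongrightarrow> (\<integral>z. indicator (C \<inter> Z) z \<partial>\<nu>)"
    proof (rule integral_dominated_convergence[where w = "\<lambda>_. 1"])
      show "(\<lambda>z. indicator (C \<inter> Z) z :: real) \<in> borel_measurable \<nu>" using CZ by simp
      show "(\<lambda>z. max 0 (1 - real n * infdist z C)) \<in> borel_measurable \<nu>" for n
        by (rule borel_probs_measurable[OF \<nu>]) (intro continuous_intros)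
      show "AE z in \<nu>. (\<lambda>n. max 0 (1 - real n * infdist z C)) \<longlonglongrightarrow> indicator (C \<inter> Z) z"
      proof (rule AE_I2)
        fix z assume "z \<in> space \<nu>"
        then have zZ: "z \<in> Z" by (simp add: borel_probsD(3)[OF \<nu>])
        show "(\<lambda>n. max 0 (1 - real n * infdist z C)) \<longlonglongrightarrow> indicator (C \<inter> Z) z"
        proof (cases "z \<in> C")
          case True
          then show ?thesis using zZ by simp
        next
          case False
          then have d: "infdist z C > 0"
            using C infdist_pos_not_in_closed by blast
          obtain m :: nat where m: "1 / infdist z C < real m" using reals_Archimedean2 by blast
          have "\<forall>\<^sub>F n in sequentially. max 0 (1 - real n * infdist z C) = 0"
            using eventually_ge_at_top[of m]
          proof eventually_elim
            case (elim n)
            have "1 < real m * infdist z C" using m d by (simp add: field_simps)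
            also have "\<dots> \<le> real n * infdist z C" using elim d by (simp add: mult_right_mono)
            finally show ?case by simp
          qed
          then show ?thesis using False by (simp add: tendsto_eventually)
        qed
      qed
      show "AE z in \<nu>. norm (max 0 (1 - real n * infdist z C)) \<le> 1" for n
        by (rule AE_I2) (auto simp: infdist_nonneg)
    qed simp
    moreover have "C \<inter> Z \<inter> space \<nu> = C \<inter> Z" by (auto simp: borel_probsD(3)[OF \<nu>])
    ultimately show ?thesis by simp
  qed
  have lip: "(real n)-lipschitz_on Z (\<lambda>z. max 0 (1 - real n * infdist z C))" for n and C :: "'a set"
  proof (rule lipschitz_onI)
    fix x y :: 'a
    have "\<bar>max 0 (1 - real n * infdist x C) - max 0 (1 - real n * infdist y C)\<bar>
        \<le> \<bar>real n * infdist x C - real n * infdist y C\<bar>" by linarith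
    also have "\<dots> = real n * \<bar>infdist x C - infdist y C\<bar>"
      by (simp add: abs_mult flip: right_diff_distrib)
    also have "\<dots> \<le> real n * dist x y"
      by (intro mult_left_mono infdist_triangle_abs) auto
    finally show "dist (max 0 (1 - real n * infdist x C)) (max 0 (1 - real n * infdist y C))
        \<le> real n * dist x y" by (simp add: dist_real_def)
  qed simp
  have closed_eq: "measure \<nu>1 (C \<inter> Z) = measure \<nu>2 (C \<inter> Z)" if "closed C" for C
  proof (cases "C = {}")
    case False
    show ?thesis
      using lim[OF that False p1] lim[OF that False p2] by (simp add: eqL[OF lip] LIMSEQ_unique)
  qed simp
  have id_meas: "(\<lambda>z. z) \<in> borel_measurable \<nu>" if "\<nu> \<in> borel_probs Z" for \<nu> :: "'a measure"
    unfolding measurable_cong_sets[OF borel_probsD(2)[OF that] refl]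
    by (rule measurable_restrict_space1) simp
  have em: "emeasure (distr \<nu> borel (\<lambda>z. z)) A = measure \<nu> (A \<inter> Z)"
    if \<nu>: "\<nu> \<in> borel_probs Z" and A: "A \<in> sets borel" for A \<nu>
  proof -
    interpret prob_space \<nu> by (rule borel_probsD(1)[OF \<nu>])
    show ?thesis using emeasure_distr[OF id_meas[OF \<nu>] A]
      by (simp add: borel_probsD(3)[OF \<nu>] emeasure_eq_measure)
  qed
  have D: "distr \<nu>1 borel (\<lambda>z. z) = distr \<nu>2 borel (\<lambda>z. z)"
  proof (rule measure_eqI_generator_eq[where E = "Collect closed" and \<Omega> = UNIV and A = "\<lambda>_. UNIV"])
    show "Int_stable (Collect closed)" by (auto simp: Int_stable_def)
    show "sets (distr \<nu>1 borel (\<lambda>z. z)) = sigma_sets UNIV (Collect closed)"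
         "sets (distr \<nu>2 borel (\<lambda>z. z)) = sigma_sets UNIV (Collect closed)"
      by (simp_all add: borel_eq_closed)
  qed (auto simp: em[OF p1] em[OF p2] closed_eq)
  show ?thesis
  proof (rule measure_eqI)
    show "sets \<nu>1 = sets \<nu>2" by (simp add: borel_probsD(2)[OF p1] borel_probsD(2)[OF p2])
    fix A assume "A \<in> sets \<nu>1"
    then obtain B where B: "B \<in> sets borel" "A = B \<inter> Z"
      by (auto simp: borel_probsD(2)[OF p1] sets_restrict_space)
    have "emeasure \<nu>i A = measure \<nu>i A" if "\<nu>i \<in> borel_probs Z" for \<nu>i
    proof -
      interpret prob_space \<nu>i by (rule borel_probsD(1)[OF that])
      show ?thesis by (rule emeasure_eq_measure)
    qed
    then show "emeasure \<nu>1 A = emeasure \<nu>2 A"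
      using em[OF p1 B(1)] em[OF p2 B(1)] D p1 p2 B(2) by simp
  qed
qed

lemma wasserstein_bdd_above:
  fixes Y :: "'a::metric_space set"
  assumes Y: "compact Y" and p1: "\<nu>1 \<in> borel_probs Y" and p2: "\<nu>2 \<in> borel_probs Y"
  shows "bdd_above ((\<lambda>\<phi>. (\<integral>y. \<phi> y \<partial>\<nu>1) - (\<integral>y. \<phi> y \<partial>\<nu>2)) ` {\<phi> :: 'a \<Rightarrow> real. 1-lipschitz_on Y \<phi>})"
proof (rule bdd_aboveI2)
  fix \<phi> :: "'a \<Rightarrow> real" assume "\<phi> \<in> {\<phi>. 1-lipschitz_on Y \<phi>}"
  then have l: "1-lipschitz_on Y \<phi>" by simp
  interpret p1: prob_space \<nu>1 by (rule borel_probsD(1)[OF p1])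
  interpret p2: prob_space \<nu>2 by (rule borel_probsD(1)[OF p2])
  obtain y0 where y0: "y0 \<in> Y" using p1.not_empty borel_probsD(3)[OF p1] by auto
  have b: "\<bar>\<phi> y - \<phi> y0\<bar> \<le> diameter Y" if "y \<in> Y" for y
    using lipschitz_onD[OF l that y0] diameter_bounded_bound[OF compact_imp_bounded[OF Y] that y0]
    by (simp add: dist_real_def)
  have i: "integrable \<nu>1 \<phi>" "integrable \<nu>2 \<phi>"
    using borel_probs_integrable[OF _ lipschitz_on_continuous_on[OF l]
        lipschitz_on_bounded_image[OF Y l]] p1 p2 by auto
  have "(\<integral>y. \<phi> y \<partial>\<nu>1) \<le> \<phi> y0 + diameter Y"
  proof (rule p1.integral_le_const[OF i(1)], rule AE_I2)
    fix y assume "y \<in> space \<nu>1"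
    then show "\<phi> y \<le> \<phi> y0 + diameter Y" using b[of y] borel_probsD(3)[OF p1] by simp
  qed
  moreover have "(\<integral>y. \<phi> y \<partial>\<nu>2) \<ge> \<phi> y0 - diameter Y"
  proof (rule p2.integral_ge_const[OF i(2)], rule AE_I2)
    fix y assume "y \<in> space \<nu>2"
    then show "\<phi> y0 - diameter Y \<le> \<phi> y" using b[of y] borel_probsD(3)[OF p2] by simp
  qed
  ultimately show "(\<integral>y. \<phi> y \<partial>\<nu>1) - (\<integral>y. \<phi> y \<partial>\<nu>2) \<le> 2 * diameter Y" by simp
qed

lemma wasserstein_upper:
  fixes Y :: "'a::metric_space set"
  assumes Y: "compact Y" and p1: "\<nu>1 \<in> borel_probs Y" and p2: "\<nu>2 \<in> borel_probs Y"
    and l: "1-lipschitz_on Y \<phi>"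
  shows "(\<integral>y. \<phi> y \<partial>\<nu>1) - (\<integral>y. \<phi> y \<partial>\<nu>2) \<le> wasserstein Y \<nu>1 \<nu>2"
  unfolding wasserstein_def
  using cSUP_upper[OF _ wasserstein_bdd_above[OF Y p1 p2], of \<phi>] p1 p2 l by simp

lemma lipschitz_on_zero_fun: "1-lipschitz_on Y (\<lambda>_. 0::real)"
  by (auto simp: lipschitz_on_def)

lemma Metric_space_wasserstein:
  fixes Y :: "'a::metric_space set"
  assumes Y: "compact Y"
  shows "Metric_space (borel_probs Y) (wasserstein Y)"
proof
  show nn: "0 \<le> wasserstein Y \<nu>1 \<nu>2" for \<nu>1 \<nu>2
  proof (cases "\<nu>1 \<in> borel_probs Y \<and> \<nu>2 \<in> borel_probs Y")
    case True
    then show ?thesis using wasserstein_upper[OF Y _ _ lipschitz_on_zero_fun] by auto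
  qed (auto simp: wasserstein_def)
  show comm: "wasserstein Y \<nu>1 \<nu>2 = wasserstein Y \<nu>2 \<nu>1" for \<nu>1 \<nu>2
  proof -
    have sub: "(\<lambda>\<phi>. (\<integral>y. \<phi> y \<partial>\<nu>1) - (\<integral>y. \<phi> y \<partial>\<nu>2)) ` {\<phi> :: 'a \<Rightarrow> real. 1-lipschitz_on Y \<phi>}
        \<subseteq> (\<lambda>\<phi>. (\<integral>y. \<phi> y \<partial>\<nu>2) - (\<integral>y. \<phi> y \<partial>\<nu>1)) ` {\<phi> :: 'a \<Rightarrow> real. 1-lipschitz_on Y \<phi>}"
      for \<nu>1 \<nu>2 :: "'a measure"
    proof (rule image_subsetI)
      fix \<phi> :: "'a \<Rightarrow> real" assume "\<phi> \<in> {\<phi>. 1-lipschitz_on Y \<phi>}"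
      then have "(\<lambda>y. - \<phi> y) \<in> {\<phi>. 1-lipschitz_on Y \<phi>}"
        by (simp add: lipschitz_on_def dist_minus)
      then show "(\<integral>y. \<phi> y \<partial>\<nu>1) - (\<integral>y. \<phi> y \<partial>\<nu>2)
          \<in> (\<lambda>\<phi>. (\<integral>y. \<phi> y \<partial>\<nu>2) - (\<integral>y. \<phi> y \<partial>\<nu>1)) ` {\<phi> :: 'a \<Rightarrow> real. 1-lipschitz_on Y \<phi>}"
        by (rule rev_image_eqI) simp
    qed
    show ?thesis
      unfolding wasserstein_def using subset_antisym[OF sub[of \<nu>1 \<nu>2] sub[of \<nu>2 \<nu>1]] by auto
  qed
  show "wasserstein Y \<nu>1 \<nu>2 = 0 \<longleftrightarrow> \<nu>1 = \<nu>2"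
    if p1: "\<nu>1 \<in> borel_probs Y" and p2: "\<nu>2 \<in> borel_probs Y" for \<nu>1 \<nu>2
  proof
    assume z: "wasserstein Y \<nu>1 \<nu>2 = 0"
    show "\<nu>1 = \<nu>2"
    proof (rule borel_probs_eqI[OF Y p1 p2])
      fix \<phi> :: "'a \<Rightarrow> real" assume l: "1-lipschitz_on Y \<phi>"
      show "(\<integral>z. \<phi> z \<partial>\<nu>1) = (\<integral>z. \<phi> z \<partial>\<nu>2)"
        using wasserstein_upper[OF Y p1 p2 l] wasserstein_upper[OF Y p2 p1 l] z comm[of \<nu>1 \<nu>2] by simp
    qed
  next
    assume "\<nu>1 = \<nu>2"
    moreover have "{\<phi> :: 'a \<Rightarrow> real. 1-lipschitz_on Y \<phi>} \<noteq> {}" using lipschitz_on_zero_fun by blast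
    ultimately show "wasserstein Y \<nu>1 \<nu>2 = 0" by (simp add: wasserstein_def)
  qed
  show "wasserstein Y \<nu>1 \<nu>3 \<le> wasserstein Y \<nu>1 \<nu>2 + wasserstein Y \<nu>2 \<nu>3"
    if p: "\<nu>1 \<in> borel_probs Y" "\<nu>2 \<in> borel_probs Y" "\<nu>3 \<in> borel_probs Y" for \<nu>1 \<nu>2 \<nu>3
  proof -
    have ne: "{\<phi> :: 'a \<Rightarrow> real. 1-lipschitz_on Y \<phi>} \<noteq> {}" using lipschitz_on_zero_fun by blast
    have "(SUP \<phi>\<in>{\<phi>. 1-lipschitz_on Y \<phi>}. (\<integral>y. \<phi> y \<partial>\<nu>1) - (\<integral>y. \<phi> y \<partial>\<nu>3))
        \<le> wasserstein Y \<nu>1 \<nu>2 + wasserstein Y \<nu>2 \<nu>3"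
    proof (rule cSUP_least[OF ne])
      fix \<phi> :: "'a \<Rightarrow> real" assume "\<phi> \<in> {\<phi>. 1-lipschitz_on Y \<phi>}"
      then have l: "1-lipschitz_on Y \<phi>" by simp
      show "(\<integral>y. \<phi> y \<partial>\<nu>1) - (\<integral>y. \<phi> y \<partial>\<nu>3) \<le> wasserstein Y \<nu>1 \<nu>2 + wasserstein Y \<nu>2 \<nu>3"
        using wasserstein_upper[OF Y p(1) p(2) l] wasserstein_upper[OF Y p(2) p(3) l] by simp
    qed
    then show ?thesis using p by (simp add: wasserstein_def[of Y \<nu>1 \<nu>3])
  qed
qed

lemma sets_restrict_borel_openin:
  "sets (restrict_space borel Y) = sigma_sets Y {B. openin (top_of_set Y) B}"
proof -
  have "sets (restrict_space borel Y) = {(\<lambda>y. y) -` A \<inter> Y |A. A \<in> sigma_sets UNIV {S. open S}}"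
    by (auto simp: sets_restrict_space borel_def)
  also have "\<dots> = sigma_sets Y {(\<lambda>y. y) -` B \<inter> Y |B. B \<in> {S. open S}}"
    by (rule sigma_sets_vimage_commute) simp
  also have "{(\<lambda>y. y) -` B \<inter> Y |B. B \<in> {S. open S}} = {B. openin (top_of_set Y) B}"
    by (auto simp: openin_open)
  finally show ?thesis .
qed

lemma disintegration_map_kernel:
  assumes f: "disintegration_map X Y f"
  shows "f \<in> restrict_space borel X \<rightarrow>\<^sub>M prob_algebra (restrict_space borel Y)"
proof (rule measurable_prob_algebra_generated[OF sets_restrict_borel_openin])
  show "Int_stable {B. openin (top_of_set Y) B}" by (auto simp: Int_stable_def)
  show "{B. openin (top_of_set Y) B} \<subseteq> Pow Y" by (auto dest: openin_imp_subset)
  fix x assume "x \<in> space (restrict_space borel X)"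
  then have "f x \<in> borel_probs Y"
    using f by (auto simp: disintegration_map_def space_restrict_space)
  then show "prob_space (f x)" "sets (f x) = sets (restrict_space borel Y)"
    by (auto simp: borel_probs_def)
next
  fix B assume B: "B \<in> {B. openin (top_of_set Y) B}"
  have "(\<lambda>x. ennreal (measure (f x) B)) \<in> borel_measurable (restrict_space borel X)"
    using f B by (auto simp: disintegration_map_def)
  also have "?this \<longleftrightarrow> (\<lambda>x. emeasure (f x) B) \<in> borel_measurable (restrict_space borel X)"
  proof (rule measurable_cong)
    fix x assume "x \<in> space (restrict_space borel X)"
    then have "f x \<in> borel_probs Y"
      using f by (auto simp: disintegration_map_def space_restrict_space)
    then interpret prob_space "f x" by (rule borel_probsD)
    show "ennreal (measure (f x) B) = emeasure (f x) B" by (simp add: emeasure_eq_measure)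
  qed
  finally show "(\<lambda>x. emeasure (f x) B) \<in> borel_measurable (restrict_space borel X)" .
qed

lemma disint_prod_ex1:
  fixes X :: "'a::{metric_space, second_countable_topology} set"
    and Y :: "'b::{metric_space, second_countable_topology} set"
  assumes X: "compact X" and Y: "compact Y" and \<mu>: "\<mu> \<in> borel_probs X"
    and f: "disintegration_map X Y f"
  shows "\<exists>!\<gamma>. \<gamma> \<in> borel_probs (X \<times> Y) \<and>
     (\<forall>\<phi> :: 'a \<times> 'b \<Rightarrow> real. continuous_on (X \<times> Y) \<phi> \<and> bounded (\<phi> ` (X \<times> Y)) \<longrightarrow>
        (\<integral>z. \<phi> z \<partial>\<gamma>) = (\<integral>x. (\<integral>y. \<phi> (x, y) \<partial>f x) \<partial>\<mu>))"
proof (rule ex_ex1I)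
  let ?X = "restrict_space borel X" and ?Y = "restrict_space borel Y"
  let ?Z = "restrict_space borel (X \<times> Y)"
  let ?K = "\<lambda>x. distr (f x) ?Z (Pair x)"
  interpret \<mu>: prob_space \<mu> by (rule borel_probsD(1)[OF \<mu>])
  have sp\<mu>: "space \<mu> = X" by (rule borel_probsD(3)[OF \<mu>])
  have fk: "f \<in> \<mu> \<rightarrow>\<^sub>M prob_algebra ?Y"
    using disintegration_map_kernel[OF f] measurable_cong_sets[OF borel_probsD(2)[OF \<mu>] refl] by blast
  have pair: "(\<lambda>(x, y). (x, y)) \<in> \<mu> \<Otimes>\<^sub>M ?Y \<rightarrow>\<^sub>M ?Z"
  proof -
    have "(\<lambda>(x, y). (x, y)) \<in> ?X \<Otimes>\<^sub>M ?Y \<rightarrow>\<^sub>M borel \<Otimes>\<^sub>M borel"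
      unfolding case_prod_unfold
      by (intro measurable_Pair measurable_compose[OF measurable_fst]
          measurable_compose[OF measurable_snd] measurable_restrict_space1) simp_all
    then have "(\<lambda>(x, y). (x, y)) \<in> ?X \<Otimes>\<^sub>M ?Y \<rightarrow>\<^sub>M ?Z"
      by (intro measurable_restrict_space2)
         (auto simp: borel_prod space_pair_measure space_restrict_space)
    then show ?thesis
      using measurable_cong_sets[OF sets_pair_measure_cong[OF borel_probsD(2)[OF \<mu>] refl] refl] by blast
  qed
  have K: "?K \<in> \<mu> \<rightarrow>\<^sub>M subprob_algebra ?Z"
    by (rule measurable_distr2[OF pair measurable_prob_algebraD[OF fk]])
  have px: "Pair x \<in> f x \<rightarrow>\<^sub>M ?Z" and fx: "f x \<in> borel_probs Y" if "x \<in> X" for x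
  proof -
    show fx: "f x \<in> borel_probs Y" using f that by (auto simp: disintegration_map_def)
    have "Pair x \<in> ?Y \<rightarrow>\<^sub>M \<mu> \<Otimes>\<^sub>M ?Y" using that sp\<mu> by simp
    from measurable_compose[OF this pair] have "Pair x \<in> ?Y \<rightarrow>\<^sub>M ?Z" by simp
    then show "Pair x \<in> f x \<rightarrow>\<^sub>M ?Z"
      using measurable_cong_sets[OF borel_probsD(2)[OF fx] refl] by blast
  qed
  show "\<exists>\<gamma>. \<gamma> \<in> borel_probs (X \<times> Y) \<and>
     (\<forall>\<phi> :: 'a \<times> 'b \<Rightarrow> real. continuous_on (X \<times> Y) \<phi> \<and> bounded (\<phi> ` (X \<times> Y)) \<longrightarrow>
        (\<integral>z. \<phi> z \<partial>\<gamma>) = (\<integral>x. (\<integral>y. \<phi> (x, y) \<partial>f x) \<partial>\<mu>))"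
  proof (intro exI[of _ "\<mu> \<bind> ?K"] conjI allI impI)
    have "prob_space (?K x)" if "x \<in> X" for x
    proof -
      interpret prob_space "f x" by (rule borel_probsD(1)[OF fx[OF that]])
      show ?thesis by (rule prob_space_distr[OF px[OF that]])
    qed
    then have "prob_space (\<mu> \<bind> ?K)"
      by (intro \<mu>.prob_space_bind[OF _ K] AE_I2) (simp add: sp\<mu>)
    moreover have "sets (\<mu> \<bind> ?K) = sets ?Z"
      by (rule sets_bind) (use \<mu>.not_empty in auto)
    ultimately show "\<mu> \<bind> ?K \<in> borel_probs (X \<times> Y)" by (simp add: borel_probs_def)
    fix \<phi> :: "'a \<times> 'b \<Rightarrow> real"
    assume \<phi>: "continuous_on (X \<times> Y) \<phi> \<and> bounded (\<phi> ` (X \<times> Y))"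
    obtain B where B: "\<And>z. z \<in> X \<times> Y \<Longrightarrow> norm (\<phi> z) \<le> B"
      using \<phi> by (auto simp: bounded_iff)
    have m: "\<phi> \<in> borel_measurable ?Z"
      using \<phi> by (intro borel_measurable_continuous_on_restrict) auto
    have "(\<integral>z. \<phi> z \<partial>(\<mu> \<bind> ?K)) = (\<integral>x. \<integral>z. \<phi> z \<partial>?K x \<partial>\<mu>)"
    proof (rule integral_bind[OF m _ K, where B' = 1 and B = B])
      show "\<bar>\<phi> z\<bar> \<le> B" if "z \<in> space ?Z" for z
        using B[of z] that by (simp add: space_restrict_space)
      show "finite_measure \<mu>" by unfold_locales
      show "AE x in \<mu>. emeasure (?K x) (space (?K x)) \<le> ennreal 1"
      proof (rule AE_I2)
        fix x assume "x \<in> space \<mu>"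
        then have "subprob_space (?K x)"
          using measurable_space[OF K] by (simp add: space_subprob_algebra)
        then show "emeasure (?K x) (space (?K x)) \<le> ennreal 1"
          using subprob_space.emeasure_space_le_1 by fastforce
      qed
    qed
    also have "\<dots> = (\<integral>x. (\<integral>y. \<phi> (x, y) \<partial>f x) \<partial>\<mu>)"
      by (rule Bochner_Integration.integral_cong[OF refl]) (simp add: integral_distr[OF px m] sp\<mu>)
    finally show "(\<integral>z. \<phi> z \<partial>(\<mu> \<bind> ?K)) = (\<integral>x. (\<integral>y. \<phi> (x, y) \<partial>f x) \<partial>\<mu>)" .
  qed
next
  fix \<gamma> \<eta>
  assume \<gamma>: "\<gamma> \<in> borel_probs (X \<times> Y) \<and>
     (\<forall>\<phi> :: 'a \<times> 'b \<Rightarrow> real. continuous_on (X \<times> Y) \<phi> \<and> bounded (\<phi> ` (X \<times> Y)) \<longrightarrow>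
        (\<integral>z. \<phi> z \<partial>\<gamma>) = (\<integral>x. (\<integral>y. \<phi> (x, y) \<partial>f x) \<partial>\<mu>))"
    and \<eta>: "\<eta> \<in> borel_probs (X \<times> Y) \<and>
     (\<forall>\<phi> :: 'a \<times> 'b \<Rightarrow> real. continuous_on (X \<times> Y) \<phi> \<and> bounded (\<phi> ` (X \<times> Y)) \<longrightarrow>
        (\<integral>z. \<phi> z \<partial>\<eta>) = (\<integral>x. (\<integral>y. \<phi> (x, y) \<partial>f x) \<partial>\<mu>))"
  show "\<gamma> = \<eta>"
  proof (rule borel_probs_eqI[OF compact_Times[OF X Y]])
    fix \<phi> :: "'a \<times> 'b \<Rightarrow> real" assume l: "1-lipschitz_on (X \<times> Y) \<phi>"
    have "continuous_on (X \<times> Y) \<phi> \<and> bounded (\<phi> ` (X \<times> Y))"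
      using lipschitz_on_continuous_on[OF l]
        lipschitz_on_bounded_image[OF compact_Times[OF X Y] l] by blast
    then show "(\<integral>z. \<phi> z \<partial>\<gamma>) = (\<integral>z. \<phi> z \<partial>\<eta>)" using \<gamma> \<eta> by simp
  qed (use \<gamma> \<eta> in auto)
qed

end

theory Submission
  imports Defs
begin

text \<open>
  For a \<open>1\<close>-Lipschitz \<open>\<phi>\<close> on \<open>Y\<close>, the evaluation \<open>E \<nu> = \<integral>\<phi> d\<nu>\<close> is \<open>1\<close>-Lipschitz for the
  Wasserstein distance, hence Borel on \<open>\<P>(Y)\<close>. Testing the second marginal of \<open>f(x) \<otimes> \<mu>\<close>
  against \<open>\<phi>\<close> gives \<open>\<integral>E (f x) d\<mu>\<close>, which by change of variables is the integral of \<open>E\<close> against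
  the push-forward of \<open>\<mu>\<close> by \<open>f\<close>. So the push-forward determines the marginal on Lipschitz test
  functions, and these separate measures on a compact set.

  The change of variables is legitimate only if \<open>f\<close> is measurable for the \<^emph>\<open>Wasserstein\<close> Borel
  sets, whereas a disintegration map is by definition measurable only for the \<open>\<sigma>\<close>-algebra of the
  evaluations \<open>\<nu> \<mapsto> \<nu>(B)\<close>. The main work is to show that every Wasserstein-open set lies in the
  latter \<open>\<sigma>\<close>-algebra (\<open>openin_wasserstein_measurable\<close>). Compactness enters here: \<open>Y\<close> splits into
  finitely many Borel cells of small diameter, and two measures giving nearly equal mass to each
  cell are close in Wasserstein distance. Rounding the masses of the cells therefore cuts
  \<open>\<P>(Y)\<close> into countably many evaluation-measurable pieces of arbitrarily small diameter
  (\<open>small_countable_coding\<close>), and an open set is the union of the pieces, over all scales, that it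
  contains.
\<close>

section \<open>Wasserstein-Borel sets and evaluations on Borel sets\<close>

lemma space_prob_algebra_borel_probs:
  "space (prob_algebra (restrict_space borel Z)) = borel_probs Z"
  by (auto simp: space_prob_algebra borel_probs_def)

text \<open>The cells are described by a labelling \<open>k\<close>; the cell with label \<open>i\<close> lies within \<open>d\<close>
  of \<open>a i\<close>.\<close>

lemma small_cells:
  fixes Y :: "'a::metric_space set"
  assumes Y: "compact Y" and d: "d > 0"
  obtains m :: nat and a :: "nat \<Rightarrow> 'a" and k :: "'a \<Rightarrow> nat"
  where "k \<in> restrict_space borel Y \<rightarrow>\<^sub>M count_space UNIV"
    and "\<And>i. i < m \<Longrightarrow> a i \<in> Y"
    and "\<And>y. y \<in> Y \<Longrightarrow> k y < m"
    and "\<And>y. y \<in> Y \<Longrightarrow> dist (a (k y)) y < d"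
proof -
  obtain F where F: "finite F" "F \<subseteq> Y" "Y \<subseteq> (\<Union>x\<in>F. ball x d)"
    using compactE_image[OF Y, of Y "\<lambda>x. ball x d"] d by force
  obtain a :: "nat \<Rightarrow> 'a" and m where a: "F = a ` {i. i < m}"
    using finite_imp_nat_seg_image_inj_on[OF F(1)] by blast
  define k where "k y = (LEAST i. dist (a i) y < d)" for y
  have ex: "\<exists>i<m. dist (a i) y < d" if "y \<in> Y" for y
    using F(3) that by (force simp: a)
  show ?thesis
  proof (rule that)
    show "k \<in> restrict_space borel Y \<rightarrow>\<^sub>M count_space UNIV"
      unfolding k_def
    proof (intro measurable_restrict_space1 measurable_Least)
      fix i
      have "open {y. dist (a i) y < d}"
        using open_ball[of "a i" d] by (simp add: ball_def)
      then show "Measurable.pred borel (\<lambda>y. dist (a i) y < d)"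
        by (simp add: pred_def)
    qed
    show "a i \<in> Y" if "i < m" for i using F(2) that by (auto simp: a)
    fix y assume "y \<in> Y"
    then obtain i where i: "i < m" "dist (a i) y < d" using ex by blast
    show "k y < m" using Least_le[of "\<lambda>i. dist (a i) y < d", OF i(2)] i(1) by (simp add: k_def)
    show "dist (a (k y)) y < d"
      using LeastI[of "\<lambda>i. dist (a i) y < d", OF i(2)] by (simp add: k_def)
  qed
qed

text \<open>The sum is the integral of the step function \<open>\<phi> (a (k y))\<close>, which is uniformly
  \<open>d\<close>-close to \<open>\<phi>\<close>.\<close>

lemma integral_cell_approx:
  fixes Y :: "'a::metric_space set" and \<phi> :: "'a \<Rightarrow> real"
  assumes Y: "compact Y" and \<nu>: "\<nu> \<in> borel_probs Y" and l: "1-lipschitz_on Y \<phi>"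
    and k: "k \<in> restrict_space borel Y \<rightarrow>\<^sub>M count_space (UNIV :: nat set)"
    and a: "\<And>i. i < m \<Longrightarrow> a i \<in> Y" and km: "\<And>y. y \<in> Y \<Longrightarrow> k y < m"
    and kd: "\<And>y. y \<in> Y \<Longrightarrow> dist (a (k y)) y < d"
  shows "\<bar>(\<integral>y. \<phi> y \<partial>\<nu>) - (\<Sum>i<m. \<phi> (a i) * measure \<nu> (k -` {i} \<inter> Y))\<bar> \<le> d"
proof -
  interpret prob_space \<nu> by (rule borel_probsD(1)[OF \<nu>])
  have sp: "space \<nu> = Y" by (rule borel_probsD(3)[OF \<nu>])
  have A: "k -` {i} \<inter> Y \<in> sets \<nu>" for i
    using measurable_sets[OF k, of "{i}"]
    by (simp add: borel_probsD(2)[OF \<nu>] space_restrict_space)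
  define s where "s y = (\<Sum>i<m. \<phi> (a i) * indicator (k -` {i} \<inter> Y) y)" for y
  have s: "s y = \<phi> (a (k y))" if "y \<in> Y" for y
  proof -
    have "s y = (\<Sum>i<m. if i = k y then \<phi> (a i) else 0)"
      unfolding s_def by (rule sum.cong) (use that in \<open>auto simp: indicator_def\<close>)
    also have "\<dots> = \<phi> (a (k y))" using km[OF that] by simp
    finally show ?thesis .
  qed
  have int_s: "integrable \<nu> s"
    unfolding s_def
    by (intro Bochner_Integration.integrable_sum integrable_mult_right
        integrable_real_indicator A) (simp add: less_top[symmetric])
  have i: "integrable \<nu> \<phi>"
    by (rule borel_probs_integrable[OF \<nu> lipschitz_on_continuous_on[OF l]
          lipschitz_on_bounded_image[OF Y l]])
  have "(\<integral>y. s y \<partial>\<nu>) = (\<Sum>i<m. \<phi> (a i) * measure \<nu> (k -` {i} \<inter> Y))"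
    unfolding s_def
  proof (subst Bochner_Integration.integral_sum)
    show "integrable \<nu> (\<lambda>y. \<phi> (a i) * indicator (k -` {i} \<inter> Y) y)" for i
      by (intro integrable_mult_right integrable_real_indicator A) (simp add: less_top[symmetric])
  qed (simp add: sp)
  then have "(\<integral>y. \<phi> y \<partial>\<nu>) - (\<Sum>i<m. \<phi> (a i) * measure \<nu> (k -` {i} \<inter> Y)) = (\<integral>y. \<phi> y - s y \<partial>\<nu>)"
    by (simp add: Bochner_Integration.integral_diff[OF i int_s])
  also have "\<bar>\<dots>\<bar> \<le> d"
  proof -
    have b: "\<bar>\<phi> y - s y\<bar> \<le> d" if "y \<in> Y" for y
      using lipschitz_onD[OF l that a[OF km[OF that]]] kd[OF that] s[OF that]
      by (simp add: dist_real_def dist_commute)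
    have "(\<integral>y. \<phi> y - s y \<partial>\<nu>) \<le> d"
      by (rule integral_le_const[OF Bochner_Integration.integrable_diff[OF i int_s]], rule AE_I2)
         (use b sp in \<open>auto simp only: abs_le_iff\<close>)
    moreover have "(\<integral>y. \<phi> y - s y \<partial>\<nu>) \<ge> - d"
      by (rule integral_ge_const[OF Bochner_Integration.integrable_diff[OF i int_s]], rule AE_I2)
         (use b sp in \<open>fastforce simp only: abs_le_iff\<close>)
    ultimately show ?thesis by linarith
  qed
  finally show ?thesis .
qed

text \<open>Since both measures have mass \<open>1\<close>, \<open>\<phi>\<close> may be shifted to vanish at a point of \<open>Y\<close>,
  and then it is bounded by the diameter; this makes the bound uniform in \<open>\<phi>\<close>.\<close>

lemma wasserstein_le_cell_masses:
  fixes Y :: "'a::metric_space set"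
  assumes Y: "compact Y" and p1: "\<nu>1 \<in> borel_probs Y" and p2: "\<nu>2 \<in> borel_probs Y"
    and k: "k \<in> restrict_space borel Y \<rightarrow>\<^sub>M count_space (UNIV :: nat set)"
    and a: "\<And>i. i < m \<Longrightarrow> a i \<in> Y" and km: "\<And>y. y \<in> Y \<Longrightarrow> k y < m"
    and kd: "\<And>y. y \<in> Y \<Longrightarrow> dist (a (k y)) y < d"
  shows "wasserstein Y \<nu>1 \<nu>2 \<le> 2 * d
    + diameter Y * (\<Sum>i<m. \<bar>measure \<nu>1 (k -` {i} \<inter> Y) - measure \<nu>2 (k -` {i} \<inter> Y)\<bar>)"
proof -
  let ?m = "\<lambda>\<nu> i. measure \<nu> (k -` {i} \<inter> Y)"
  interpret p1: prob_space \<nu>1 by (rule borel_probsD(1)[OF p1])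
  interpret p2: prob_space \<nu>2 by (rule borel_probsD(1)[OF p2])
  obtain y0 where y0: "y0 \<in> Y" using p1.not_empty borel_probsD(3)[OF p1] by auto
  have "(\<integral>y. \<phi> y \<partial>\<nu>1) - (\<integral>y. \<phi> y \<partial>\<nu>2) \<le> 2 * d + diameter Y * (\<Sum>i<m. \<bar>?m \<nu>1 i - ?m \<nu>2 i\<bar>)"
    if l: "1-lipschitz_on Y \<phi>" for \<phi> :: "'a \<Rightarrow> real"
  proof -
    define \<psi> where "\<psi> y = \<phi> y - \<phi> y0" for y
    have l': "1-lipschitz_on Y \<psi>" using l by (auto simp: \<psi>_def lipschitz_on_def dist_real_def)
    have i: "integrable \<nu>1 \<phi>" "integrable \<nu>2 \<phi>"
      using borel_probs_integrable[OF _ lipschitz_on_continuous_on[OF l]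
          lipschitz_on_bounded_image[OF Y l]] p1 p2 by auto
    have e: "(\<integral>y. \<psi> y \<partial>\<nu>1) = (\<integral>y. \<phi> y \<partial>\<nu>1) - \<phi> y0" "(\<integral>y. \<psi> y \<partial>\<nu>2) = (\<integral>y. \<phi> y \<partial>\<nu>2) - \<phi> y0"
      unfolding \<psi>_def using i by (simp_all add: p1.prob_space p2.prob_space)
    have b: "\<bar>\<psi> (a i)\<bar> \<le> diameter Y" if "i < m" for i
      using lipschitz_onD[OF l a[OF that] y0]
        diameter_bounded_bound[OF compact_imp_bounded[OF Y] a[OF that] y0]
      by (simp add: dist_real_def \<psi>_def)
    have "(\<Sum>i<m. \<psi> (a i) * ?m \<nu>1 i) - (\<Sum>i<m. \<psi> (a i) * ?m \<nu>2 i)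
        = (\<Sum>i<m. \<psi> (a i) * (?m \<nu>1 i - ?m \<nu>2 i))"
      by (simp add: sum_subtractf right_diff_distrib)
    also have "\<dots> \<le> (\<Sum>i<m. diameter Y * \<bar>?m \<nu>1 i - ?m \<nu>2 i\<bar>)"
    proof (rule sum_mono)
      fix i assume "i \<in> {..<m}"
      then have "\<bar>\<psi> (a i) * (?m \<nu>1 i - ?m \<nu>2 i)\<bar> \<le> diameter Y * \<bar>?m \<nu>1 i - ?m \<nu>2 i\<bar>"
        unfolding abs_mult using b[of i] by (intro mult_right_mono) auto
      then show "\<psi> (a i) * (?m \<nu>1 i - ?m \<nu>2 i) \<le> diameter Y * \<bar>?m \<nu>1 i - ?m \<nu>2 i\<bar>"
        by linarith
    qed
    also have "\<dots> = diameter Y * (\<Sum>i<m. \<bar>?m \<nu>1 i - ?m \<nu>2 i\<bar>)" by (simp add: sum_distrib_left)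
    finally show ?thesis
      using integral_cell_approx[OF Y p1 l' k a km kd] integral_cell_approx[OF Y p2 l' k a km kd] e
      by linarith
  qed
  moreover have "{\<phi> :: 'a \<Rightarrow> real. 1-lipschitz_on Y \<phi>} \<noteq> {}" using lipschitz_on_zero_fun by blast
  ultimately show ?thesis
    unfolding wasserstein_def using p1 p2 by (auto intro!: cSUP_least)
qed

text \<open>The code of a measure lists the masses of the cells, rounded down to multiples of \<open>1 / N\<close>:
  a measurable map into a countable set whose fibres are small.\<close>

lemma small_countable_coding:
  fixes Y :: "'a::metric_space set"
  assumes Y: "compact Y" and e: "e > 0"
  obtains c :: "'a measure \<Rightarrow> int list"
  where "c \<in> prob_algebra (restrict_space borel Y) \<rightarrow>\<^sub>M count_space UNIV"
    and "\<And>\<nu>1 \<nu>2. \<nu>1 \<in> borel_probs Y \<Longrightarrow> \<nu>2 \<in> borel_probs Y \<Longrightarrow> c \<nu>1 = c \<nu>2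
          \<Longrightarrow> wasserstein Y \<nu>1 \<nu>2 < e"
proof -
  let ?P = "prob_algebra (restrict_space borel Y)"
  obtain m a k where k: "k \<in> restrict_space borel Y \<rightarrow>\<^sub>M count_space UNIV"
    and cells: "\<And>i. i < m \<Longrightarrow> a i \<in> Y" "\<And>y. y \<in> Y \<Longrightarrow> k y < (m :: nat)"
      "\<And>y. y \<in> Y \<Longrightarrow> dist (a (k y)) y < e / 4"
    by (rule small_cells[OF Y, of "e / 4"]) (use e in simp, blast)
  define A where "A i = k -` {i} \<inter> Y" for i
  have D: "diameter Y \<ge> 0" by (rule diameter_ge_0[OF compact_imp_bounded[OF Y]])
  obtain N :: nat where N: "4 * diameter Y * real m / e < real N" using reals_Archimedean2 by blast
  have "0 \<le> 4 * diameter Y * real m / e" using D e by simp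
  then have N0: "real N > 0" using N by linarith
  define c where "c \<nu> = map (\<lambda>i. \<lfloor>real N * measure \<nu> (A i)\<rfloor>) [0..<m]" for \<nu> :: "'a measure"
  show ?thesis
  proof (rule that)
    have A: "A i \<in> sets (restrict_space borel Y)" for i
      using measurable_sets[OF k, of "{i}"] by (simp add: A_def space_restrict_space)
    have ev: "(\<lambda>\<nu>. measure \<nu> (A i)) \<in> borel_measurable ?P" for i
      using measurable_measure_subprob_algebra[OF A] unfolding prob_algebra_def
      by (rule measurable_restrict_space1)
    have "c -` {l} \<inter> space ?P \<in> sets ?P" for l
    proof (cases "length l = m")
      case True
      have "c \<nu> = l \<longleftrightarrow> (\<forall>i\<in>{..<m}. \<lfloor>real N * measure \<nu> (A i)\<rfloor> = l ! i)" for \<nu>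
        unfolding c_def list_eq_iff_nth_eq[of _ l] using True by (simp add: Ball_def)
      then have "c -` {l} \<inter> space ?P
          = {\<nu> \<in> space ?P. \<forall>i\<in>{..<m}. \<lfloor>real N * measure \<nu> (A i)\<rfloor> = l ! i}"
        by blast
      also have "\<dots> \<in> sets ?P"
      proof (rule sets.sets_Collect_finite_All)
        show "{\<nu> \<in> space ?P. \<lfloor>real N * measure \<nu> (A i)\<rfloor> = l ! i} \<in> sets ?P" for i
        proof -
          have "(\<lambda>\<nu>. real N * measure \<nu> (A i)) \<in> borel_measurable ?P"
            by (rule borel_measurable_times[OF borel_measurable_const ev])
          then have "{\<nu> \<in> space ?P. real_of_int (l ! i) \<le> real N * measure \<nu> (A i)
              \<and> real N * measure \<nu> (A i) < real_of_int (l ! i) + 1} \<in> sets ?P"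
            by measurable
          then show ?thesis by (simp only: floor_eq_iff)
        qed
      qed simp
      finally show ?thesis .
    next
      case False
      then have "c -` {l} \<inter> space ?P = {}" by (auto simp: c_def)
      then show ?thesis by simp
    qed
    then show "c \<in> ?P \<rightarrow>\<^sub>M count_space UNIV"
      by (subst measurable_count_space_eq2_countable) auto
    fix \<nu>1 \<nu>2 assume p: "\<nu>1 \<in> borel_probs Y" "\<nu>2 \<in> borel_probs Y" and eq: "c \<nu>1 = c \<nu>2"
    have "\<bar>measure \<nu>1 (A i) - measure \<nu>2 (A i)\<bar> \<le> 1 / real N" if "i < m" for i
    proof -
      have "\<lfloor>real N * measure \<nu>1 (A i)\<rfloor> = \<lfloor>real N * measure \<nu>2 (A i)\<rfloor>"
        using eq that by (auto simp: c_def)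
      then have "\<bar>real N * measure \<nu>1 (A i) - real N * measure \<nu>2 (A i)\<bar> \<le> 1"
        by linarith
      then have "real N * \<bar>measure \<nu>1 (A i) - measure \<nu>2 (A i)\<bar> \<le> 1"
        by (simp add: abs_mult flip: right_diff_distrib)
      then show ?thesis using N0 by (simp add: field_simps)
    qed
    then have "(\<Sum>i<m. \<bar>measure \<nu>1 (A i) - measure \<nu>2 (A i)\<bar>) \<le> (\<Sum>i<m. 1 / real N)"
      by (intro sum_mono) auto
    then have "diameter Y * (\<Sum>i<m. \<bar>measure \<nu>1 (A i) - measure \<nu>2 (A i)\<bar>)
        \<le> diameter Y * (real m / real N)"
      using D by (intro mult_left_mono) auto
    also have "\<dots> < e / 4" using N N0 e by (simp add: field_simps)
    finally show "wasserstein Y \<nu>1 \<nu>2 < e"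
      using wasserstein_le_cell_masses[OF Y p k cells] e by (simp add: A_def)
  qed
qed

lemma openin_wasserstein_measurable:
  fixes Y :: "'a::metric_space set"
  assumes Y: "compact Y"
    and U: "openin (Metric_space.mtopology (borel_probs Y) (wasserstein Y)) U"
  shows "U \<in> sets (prob_algebra (restrict_space borel Y))"
proof -
  let ?P = "prob_algebra (restrict_space borel Y)"
  interpret W: Metric_space "borel_probs Y" "wasserstein Y" by (rule Metric_space_wasserstein[OF Y])
  have "\<exists>c :: 'a measure \<Rightarrow> int list. c \<in> ?P \<rightarrow>\<^sub>M count_space UNIV \<and>
      (\<forall>\<nu>1\<in>borel_probs Y. \<forall>\<nu>2\<in>borel_probs Y. c \<nu>1 = c \<nu>2
        \<longrightarrow> wasserstein Y \<nu>1 \<nu>2 < 1 / real (Suc n))" for n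
    by (rule small_countable_coding[OF Y, of "1 / real (Suc n)"]) auto
  then obtain c :: "nat \<Rightarrow> 'a measure \<Rightarrow> int list"
    where cm: "\<And>n. c n \<in> ?P \<rightarrow>\<^sub>M count_space UNIV"
    and c: "\<And>n \<nu>1 \<nu>2. \<nu>1 \<in> borel_probs Y \<Longrightarrow> \<nu>2 \<in> borel_probs Y \<Longrightarrow> c n \<nu>1 = c n \<nu>2
        \<Longrightarrow> wasserstein Y \<nu>1 \<nu>2 < 1 / real (Suc n)"
    by metis
  define V where "V n l = c n -` {l} \<inter> space ?P" for n l
  have sub: "U \<subseteq> borel_probs Y" using U by (auto simp: W.openin_mtopology)
  have "U = (\<Union>n. \<Union>l\<in>{l. V n l \<subseteq> U}. V n l)"
  proof (intro subset_antisym subsetI)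
    fix \<nu> assume \<nu>: "\<nu> \<in> U"
    then obtain r where r: "r > 0" "W.mball \<nu> r \<subseteq> U" using U by (auto simp: W.openin_mtopology)
    obtain n where n: "1 / real (Suc n) < r"
      using reals_Archimedean[OF r(1)] by (auto simp: inverse_eq_divide)
    have "V n (c n \<nu>) \<subseteq> W.mball \<nu> r"
    proof
      fix \<nu>' assume "\<nu>' \<in> V n (c n \<nu>)"
      then have "\<nu>' \<in> borel_probs Y" "c n \<nu> = c n \<nu>'"
        by (auto simp: V_def space_prob_algebra_borel_probs)
      then show "\<nu>' \<in> W.mball \<nu> r" using c[of \<nu> \<nu>' n] n \<nu> sub by (auto simp: W.in_mball)
    qed
    moreover have "\<nu> \<in> V n (c n \<nu>)"
      using \<nu> sub by (auto simp: V_def space_prob_algebra_borel_probs)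
    ultimately show "\<nu> \<in> (\<Union>n. \<Union>l\<in>{l. V n l \<subseteq> U}. V n l)" using r(2) by blast
  qed auto
  also have "\<dots> \<in> sets ?P"
  proof (intro sets.countable_UN'' countableI_type)
    show "V n l \<in> sets ?P" for n l unfolding V_def by (rule measurable_sets[OF cm]) simp
  qed
  finally show ?thesis .
qed

lemma space_wasserstein_borel: "space (wasserstein_borel Y) = borel_probs Y"
  by (simp add: wasserstein_borel_def space_measure_of_conv)

lemma disintegration_map_wasserstein_measurable:
  fixes Y :: "'b::metric_space set"
  assumes Y: "compact Y" and \<mu>: "\<mu> \<in> borel_probs X" and f: "disintegration_map X Y f"
  shows "f \<in> \<mu> \<rightarrow>\<^sub>M wasserstein_borel Y"
proof -
  let ?P = "prob_algebra (restrict_space borel Y)"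
  interpret W: Metric_space "borel_probs Y" "wasserstein Y" by (rule Metric_space_wasserstein[OF Y])
  have fk: "f \<in> \<mu> \<rightarrow>\<^sub>M ?P"
    using disintegration_map_kernel[OF f] measurable_cong_sets[OF borel_probsD(2)[OF \<mu>] refl] by blast
  have "(\<lambda>\<nu>. \<nu>) \<in> ?P \<rightarrow>\<^sub>M wasserstein_borel Y"
    unfolding wasserstein_borel_def
  proof (rule measurable_measure_of)
    show "{U. openin W.mtopology U} \<subseteq> Pow (borel_probs Y)" by (auto simp: W.openin_mtopology)
    show "(\<lambda>\<nu>. \<nu>) \<in> space ?P \<rightarrow> borel_probs Y" by (simp add: space_prob_algebra_borel_probs)
    show "(\<lambda>\<nu>. \<nu>) -` U \<inter> space ?P \<in> sets ?P" if "U \<in> {U. openin W.mtopology U}" for U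
      using openin_wasserstein_measurable[OF Y] that by (intro sets.Int) auto
  qed
  from measurable_compose[OF fk this] show ?thesis .
qed

section \<open>Testing against Lipschitz functions\<close>

text \<open>By definition of the distance, \<open>\<nu> \<mapsto> \<integral>\<phi> d\<nu>\<close> is \<open>1\<close>-Lipschitz.\<close>

lemma lipschitz_evaluation_measurable:
  fixes Y :: "'a::metric_space set" and \<phi> :: "'a \<Rightarrow> real"
  assumes Y: "compact Y" and l: "1-lipschitz_on Y \<phi>"
  shows "(\<lambda>\<nu>. \<integral>y. \<phi> y \<partial>\<nu>) \<in> borel_measurable (wasserstein_borel Y)"
proof (rule borel_measurableI)
  fix S :: "real set" assume S: "open S"
  interpret W: Metric_space "borel_probs Y" "wasserstein Y" by (rule Metric_space_wasserstein[OF Y])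
  let ?U = "(\<lambda>\<nu>. \<integral>y. \<phi> y \<partial>\<nu>) -` S \<inter> borel_probs Y"
  have "openin W.mtopology ?U"
    unfolding W.openin_mtopology
  proof (intro conjI allI impI)
    fix \<nu> assume "\<nu> \<in> ?U"
    then have \<nu>: "\<nu> \<in> borel_probs Y" "(\<integral>y. \<phi> y \<partial>\<nu>) \<in> S" by auto
    obtain r where r: "r > 0" "ball (\<integral>y. \<phi> y \<partial>\<nu>) r \<subseteq> S" using S \<nu>(2) openE by blast
    have "W.mball \<nu> r \<subseteq> ?U"
    proof
      fix \<nu>' assume "\<nu>' \<in> W.mball \<nu> r"
      then have \<nu>': "\<nu>' \<in> borel_probs Y" "wasserstein Y \<nu> \<nu>' < r" by (auto simp: W.in_mball)
      have "\<bar>(\<integral>y. \<phi> y \<partial>\<nu>) - (\<integral>y. \<phi> y \<partial>\<nu>')\<bar> < r"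
        using wasserstein_upper[OF Y \<nu>(1) \<nu>'(1) l] wasserstein_upper[OF Y \<nu>'(1) \<nu>(1) l] \<nu>'(2)
          W.commute[of \<nu> \<nu>'] by linarith
      then show "\<nu>' \<in> ?U" using r(2) \<nu>'(1) by (auto simp: dist_real_def)
    qed
    then show "\<exists>r>0. W.mball \<nu> r \<subseteq> ?U" using r(1) by blast
  qed simp
  moreover have "{U. openin W.mtopology U} \<subseteq> Pow (borel_probs Y)" by (auto simp: W.openin_mtopology)
  ultimately show "(\<lambda>\<nu>. \<integral>y. \<phi> y \<partial>\<nu>) -` S \<inter> space (wasserstein_borel Y) \<in> sets (wasserstein_borel Y)"
    by (auto simp: space_wasserstein_borel wasserstein_borel_def sets_measure_of
        intro: sigma_sets.Basic)
qed

lemma disint_prod_spec: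
  fixes X :: "'a::{metric_space, second_countable_topology} set"
    and Y :: "'b::{metric_space, second_countable_topology} set"
  assumes "compact X" "compact Y" "\<mu> \<in> borel_probs X" "disintegration_map X Y f"
  shows "disint_prod X Y f \<mu> \<in> borel_probs (X \<times> Y)"
    and "\<And>\<phi> :: 'a \<times> 'b \<Rightarrow> real. continuous_on (X \<times> Y) \<phi> \<Longrightarrow> bounded (\<phi> ` (X \<times> Y)) \<Longrightarrow>
        (\<integral>z. \<phi> z \<partial>disint_prod X Y f \<mu>) = (\<integral>x. (\<integral>y. \<phi> (x, y) \<partial>f x) \<partial>\<mu>)"
  using theI'[OF disint_prod_ex1[OF assms]] unfolding disint_prod_def[symmetric] by auto

lemma snd_measurable_borel_probs:
  assumes "\<gamma> \<in> borel_probs (X \<times> Y)"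
  shows "snd \<in> \<gamma> \<rightarrow>\<^sub>M restrict_space borel Y"
proof -
  have "snd \<in> borel_measurable (borel :: ('a::topological_space \<times> 'b::topological_space) measure)"
    by (rule borel_measurable_continuous_onI) (rule continuous_on_snd[OF continuous_on_id])
  then have "snd \<in> restrict_space (borel :: ('a \<times> 'b) measure) (X \<times> Y) \<rightarrow>\<^sub>M restrict_space borel Y"
    by (intro measurable_restrict_space2 measurable_restrict_space1)
       (auto simp: space_restrict_space)
  then show ?thesis
    using measurable_cong_sets[OF borel_probsD(2)[OF assms] refl] by blast
qed

lemma snd_marginal_borel_probs:
  assumes "\<gamma> \<in> borel_probs (X \<times> Y)"
  shows "distr \<gamma> (restrict_space borel Y) snd \<in> borel_probs Y"
  using prob_space.prob_space_distr[OF borel_probsD(1)[OF assms] snd_measurable_borel_probs[OF assms]]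
  by (simp add: borel_probs_def)

text \<open>The second marginal integrates \<open>\<phi>\<close> to a quantity that depends on \<open>f\<close> and \<open>\<mu>\<close> only through
  the push-forward of \<open>\<mu>\<close> by \<open>f\<close>.\<close>

lemma integral_snd_marginal:
  fixes X :: "'a::{metric_space, second_countable_topology} set"
    and Y :: "'b::{metric_space, second_countable_topology} set"
    and \<phi> :: "'b \<Rightarrow> real"
  assumes X: "compact X" and Y: "compact Y" and \<mu>: "\<mu> \<in> borel_probs X"
    and f: "disintegration_map X Y f" and l: "1-lipschitz_on Y \<phi>"
  shows "(\<integral>y. \<phi> y \<partial>distr (disint_prod X Y f \<mu>) (restrict_space borel Y) snd)
    = (\<integral>\<nu>. (\<integral>y. \<phi> y \<partial>\<nu>) \<partial>distr \<mu> (wasserstein_borel Y) f)"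
proof -
  note spec = disint_prod_spec[OF X Y \<mu> f]
  have cont: "continuous_on Y \<phi>" by (rule lipschitz_on_continuous_on[OF l])
  have "continuous_on (X \<times> Y) (\<lambda>z. \<phi> (snd z))"
    by (rule continuous_on_compose2[OF cont]) (auto intro: continuous_intros)
  moreover have "bounded ((\<lambda>z. \<phi> (snd z)) ` (X \<times> Y))"
    by (rule bounded_subset[OF lipschitz_on_bounded_image[OF Y l]]) auto
  ultimately have "(\<integral>z. \<phi> (snd z) \<partial>disint_prod X Y f \<mu>) = (\<integral>x. (\<integral>y. \<phi> y \<partial>f x) \<partial>\<mu>)"
    using spec(2)[of "\<lambda>z. \<phi> (snd z)"] by simp
  moreover have "(\<integral>y. \<phi> y \<partial>distr (disint_prod X Y f \<mu>) (restrict_space borel Y) snd)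
      = (\<integral>z. \<phi> (snd z) \<partial>disint_prod X Y f \<mu>)"
    by (rule integral_distr[OF snd_measurable_borel_probs[OF spec(1)]
          borel_measurable_continuous_on_restrict[OF cont]])
  moreover have "(\<integral>\<nu>. (\<integral>y. \<phi> y \<partial>\<nu>) \<partial>distr \<mu> (wasserstein_borel Y) f) = (\<integral>x. (\<integral>y. \<phi> y \<partial>f x) \<partial>\<mu>)"
    by (rule integral_distr[OF disintegration_map_wasserstein_measurable[OF Y \<mu> f]
          lipschitz_evaluation_measurable[OF Y l]])
  ultimately show ?thesis by simp
qed

theorem lemma1p5:
  fixes X Y :: "(real ^ 'n) set"
    and \<mu> :: "(real ^ 'n) measure"
    and f g :: "(real ^ 'n) \<Rightarrow> (real ^ 'n) measure"
    and \<gamma> \<eta> :: "((real ^ 'n) \<times> (real ^ 'n)) measure"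
  assumes "compact X" and "compact Y"
    and "\<mu> \<in> borel_probs X"
    and "disintegration_map X Y f" and "disintegration_map X Y g"
    and "\<gamma> = disint_prod X Y f \<mu>" and "\<eta> = disint_prod X Y g \<mu>"
    and "distr \<mu> (wasserstein_borel Y) f = distr \<mu> (wasserstein_borel Y) g"
  shows "distr \<gamma> (restrict_space borel Y) snd = distr \<eta> (restrict_space borel Y) snd"
proof (rule borel_probs_eqI[OF assms(2)])
  show "distr \<gamma> (restrict_space borel Y) snd \<in> borel_probs Y"
    unfolding assms(6)
    by (rule snd_marginal_borel_probs[OF disint_prod_spec(1)[OF assms(1-4)]])
  show "distr \<eta> (restrict_space borel Y) snd \<in> borel_probs Y"
    unfolding assms(7)
    by (rule snd_marginal_borel_probs[OF disint_prod_spec(1)[OF assms(1-3,5)]])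
  fix \<phi> :: "real ^ 'n \<Rightarrow> real" assume l: "1-lipschitz_on Y \<phi>"
  show "(\<integral>y. \<phi> y \<partial>distr \<gamma> (restrict_space borel Y) snd)
      = (\<integral>y. \<phi> y \<partial>distr \<eta> (restrict_space borel Y) snd)"
    unfolding assms(6,7) integral_snd_marginal[OF assms(1-4) l]
      integral_snd_marginal[OF assms(1-3,5) l] assms(8) ..
qed

end
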